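(* Let $R$ be a commutative semiring. The Kleisli category $\mathrm{sSet}_{D_R}$ of the distribution monad $D_R:\mathrm{sSet}\to\mathrm{sSet}$ is an $R$-convex category, with structure functor $\pi:D_R(\mathrm{sSet}_{D_R})\to\mathrm{sSet}_{D_R}$ that is the identity on objects and is given on morphisms by the maps $D_R(\mathrm{sSet}(X,D_R(Y)))\to\mathrm{sSet}(X,D_R(Y))$, $\pi(Q)_n(x)=\sum_{p\in\mathrm{sSet}(X,D_R(Y))}Q(p)\,p_n(x)$ for $x\in X_n$.
   Context: For a set $S$, $D_R(S)$ is the set of functions $p:S\to R$ of finite support with $\sum_s p(s)=1$; for $f:S\to T$, $D_R(f)(p)(t)=\sum_{f(s)=t}p(s)$. It is a monad on $\mathrm{Set}$ with unit $\delta_S(s)=\delta^s$ (delta distribution) and multiplication $\mu_S(P)(s)=\sum_pP(p)p(s)$. Applied degreewise it gives a monad $D_R$ on simplicial sets. The Kleisli category $\mathrm{sSet}_{D_R}$ has simplicial sets as objects, morphism sets $\mathrm{sSet}_{D_R}(X,Y)=\mathrm{sSet}(X,D_R(Y))$, identities $\delta_X$, and composition $(q\diamond p)_n(x)=\sum_{y\in Y_n}p_n(x)(y)\,q_n(y)$ for $p:X\to D_R(Y)$, $q:Y\to D_R(Z)$. The functor $D_R$ also gives a monad on the category $\mathrm{Cat}$ of locally small categories: $D_R(\mathcal C)$ has the same objects as $\mathcal C$, morphism sets $D_R(\mathcal C(X,Y))$, identities $\delta^{\mathrm{Id}_X}$, composition $(q*p)(f)=\sum_{g_2\circ g_1=f}q(g_2)p(g_1)$;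 for a functor $F$, $D_R(F)$ acts as $F$ on objects and as $D_R(F_{X,Y})$ on morphisms; the unit and multiplication are the identity on objects and $\delta_{\mathcal C(X,Y)}$, $\mu_{\mathcal C(X,Y)}$ on morphisms. An $R$-convex category is an algebra over this monad, i.e. a category $\mathcal C$ with a functor $\pi^{\mathcal C}:D_R(\mathcal C)\to\mathcal C$ satisfying $\pi^{\mathcal C}\circ\delta_{\mathcal C}=\mathrm{Id}$ and $\pi^{\mathcal C}\circ D_R(\pi^{\mathcal C})=\pi^{\mathcal C}\circ\mu_{\mathcal C}$. *)

theory Defs
  imports "HOL-Library.FuncSet"
begin

section \<open>Distributions\<close>

text \<open>
  The coefficients range over a type of sort \<open>{comm_semiring_0, comm_monoid_mult}\<close>, i.e. an
  arbitrary commutative semiring with unit. The class \<open>comm_semiring_1\<close> is not used because it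
  additionally demands \<open>0 \<noteq> 1\<close>.

  A function \<open>S \<rightarrow> R\<close> of finite support is represented by its extension by zero, so that an
  element of \<open>dist S\<close> is uniquely determined by its values on \<open>S\<close>. All (possibly infinitely
  indexed) sums of finitely many nonzero terms are written with \<open>sum'\<close>.
\<close>

definition dist :: "'a set \<Rightarrow> ('a \<Rightarrow> 'r::{comm_semiring_0, comm_monoid_mult}) set" where
  "dist S = {p. (\<forall>s. s \<notin> S \<longrightarrow> p s = 0) \<and> finite {s \<in> S. p s \<noteq> 0} \<and> sum' p S = 1}"

definition dist_map ::
    "'a set \<Rightarrow> ('a \<Rightarrow> 'b) \<Rightarrow> ('a \<Rightarrow> 'r::{comm_semiring_0, comm_monoid_mult}) \<Rightarrow> 'b \<Rightarrow> 'r" where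
  "dist_map S f p = (\<lambda>t. sum' p {s \<in> S. f s = t})"

definition delta :: "'a \<Rightarrow> 'a \<Rightarrow> 'r::{comm_semiring_0, comm_monoid_mult}" where
  "delta s = (\<lambda>t. if t = s then 1 else 0)"

definition dist_mult ::
    "'a set \<Rightarrow> (('a \<Rightarrow> 'r) \<Rightarrow> 'r::{comm_semiring_0, comm_monoid_mult}) \<Rightarrow> 'a \<Rightarrow> 'r" where
  "dist_mult S P = (\<lambda>s. sum' (\<lambda>p. P p * p s) (dist S))"


section \<open>Categories and functors\<close>

text \<open>
  Hom-sets of different pairs of objects need not be disjoint; therefore composition carries the
  objects as arguments, \<open>Comp C X Y Z g f\<close> being the composite of \<open>f : X \<rightarrow> Y\<close> and \<open>g : Y \<rightarrow> Z\<close>.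
  The values of the operations outside the objects and hom-sets are irrelevant.
\<close>

record ('o, 'm) cat =
  Obj :: "'o set"
  Hom :: "'o \<Rightarrow> 'o \<Rightarrow> 'm set"
  Ident :: "'o \<Rightarrow> 'm"
  Comp :: "'o \<Rightarrow> 'o \<Rightarrow> 'o \<Rightarrow> 'm \<Rightarrow> 'm \<Rightarrow> 'm"

definition category :: "('o, 'm) cat \<Rightarrow> bool" where
  "category C \<longleftrightarrow>
    (\<forall>X \<in> Obj C. Ident C X \<in> Hom C X X) \<and>
    (\<forall>X \<in> Obj C. \<forall>Y \<in> Obj C. \<forall>Z \<in> Obj C. \<forall>g \<in> Hom C Y Z. \<forall>f \<in> Hom C X Y.
      Comp C X Y Z g f \<in> Hom C X Z) \<and>
    (\<forall>X \<in> Obj C. \<forall>Y \<in> Obj C. \<forall>f \<in> Hom C X Y.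
      Comp C X X Y f (Ident C X) = f \<and> Comp C X Y Y (Ident C Y) f = f) \<and>
    (\<forall>W \<in> Obj C. \<forall>X \<in> Obj C. \<forall>Y \<in> Obj C. \<forall>Z \<in> Obj C.
      \<forall>h \<in> Hom C Y Z. \<forall>g \<in> Hom C X Y. \<forall>f \<in> Hom C W X.
        Comp C W X Z (Comp C X Y Z h g) f = Comp C W Y Z h (Comp C W X Y g f))"

record ('o, 'm, 'p, 'n) ftor =
  on_obj :: "'o \<Rightarrow> 'p"
  on_hom :: "'o \<Rightarrow> 'o \<Rightarrow> 'm \<Rightarrow> 'n"

definition is_functor :: "('o, 'm) cat \<Rightarrow> ('p, 'n) cat \<Rightarrow> ('o, 'm, 'p, 'n) ftor \<Rightarrow> bool" where
  "is_functor C D F \<longleftrightarrow> category C \<and> category D \<and>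
    (\<forall>X \<in> Obj C. on_obj F X \<in> Obj D) \<and>
    (\<forall>X \<in> Obj C. \<forall>Y \<in> Obj C. \<forall>f \<in> Hom C X Y.
      on_hom F X Y f \<in> Hom D (on_obj F X) (on_obj F Y)) \<and>
    (\<forall>X \<in> Obj C. on_hom F X X (Ident C X) = Ident D (on_obj F X)) \<and>
    (\<forall>X \<in> Obj C. \<forall>Y \<in> Obj C. \<forall>Z \<in> Obj C. \<forall>g \<in> Hom C Y Z. \<forall>f \<in> Hom C X Y.
      on_hom F X Z (Comp C X Y Z g f) =
        Comp D (on_obj F X) (on_obj F Y) (on_obj F Z) (on_hom F Y Z g) (on_hom F X Y f))"

text \<open>Equality of functors with domain \<open>C\<close>, disregarding values outside \<open>C\<close>.\<close>

definition functor_eq ::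
    "('o, 'm) cat \<Rightarrow> ('o, 'm, 'p, 'n) ftor \<Rightarrow> ('o, 'm, 'p, 'n) ftor \<Rightarrow> bool" where
  "functor_eq C F G \<longleftrightarrow>
    (\<forall>X \<in> Obj C. on_obj F X = on_obj G X) \<and>
    (\<forall>X \<in> Obj C. \<forall>Y \<in> Obj C. \<forall>f \<in> Hom C X Y. on_hom F X Y f = on_hom G X Y f)"

definition id_functor :: "('o, 'm, 'o, 'm) ftor" where
  "id_functor = \<lparr>on_obj = (\<lambda>X. X), on_hom = (\<lambda>X Y f. f)\<rparr>"

definition functor_comp ::
    "('p, 'n, 'q, 'k) ftor \<Rightarrow> ('o, 'm, 'p, 'n) ftor \<Rightarrow> ('o, 'm, 'q, 'k) ftor" where
  "functor_comp G F =
    \<lparr>on_obj = (\<lambda>X. on_obj G (on_obj F X)),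
     on_hom = (\<lambda>X Y f. on_hom G (on_obj F X) (on_obj F Y) (on_hom F X Y f))\<rparr>"


section \<open>The distribution monad on categories and its algebras\<close>

definition dist_cat ::
    "('o, 'm) cat \<Rightarrow> ('o, 'm \<Rightarrow> 'r::{comm_semiring_0, comm_monoid_mult}) cat" where
  "dist_cat C =
    \<lparr>Obj = Obj C,
     Hom = (\<lambda>X Y. dist (Hom C X Y)),
     Ident = (\<lambda>X. delta (Ident C X)),
     Comp = (\<lambda>X Y Z q p. \<lambda>f. sum' (\<lambda>(g2, g1). q g2 * p g1)
       {(g2, g1). g2 \<in> Hom C Y Z \<and> g1 \<in> Hom C X Y \<and> Comp C X Y Z g2 g1 = f})\<rparr>"

text \<open>The action of the monad on a functor with domain \<open>C\<close>.\<close>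

definition dist_functor ::
    "('o, 'm) cat \<Rightarrow> ('o, 'm, 'p, 'n) ftor
      \<Rightarrow> ('o, 'm \<Rightarrow> 'r::{comm_semiring_0, comm_monoid_mult}, 'p, 'n \<Rightarrow> 'r) ftor" where
  "dist_functor C F =
    \<lparr>on_obj = on_obj F,
     on_hom = (\<lambda>X Y. dist_map (Hom C X Y) (on_hom F X Y))\<rparr>"

definition unit_functor ::
    "('o, 'm, 'o, 'm \<Rightarrow> 'r::{comm_semiring_0, comm_monoid_mult}) ftor" where
  "unit_functor = \<lparr>on_obj = (\<lambda>X. X), on_hom = (\<lambda>X Y. delta)\<rparr>"

definition mult_functor ::
    "('o, 'm) cat
      \<Rightarrow> ('o, ('m \<Rightarrow> 'r) \<Rightarrow> 'r::{comm_semiring_0, comm_monoid_mult}, 'o, 'm \<Rightarrow> 'r) ftor" where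
  "mult_functor C = \<lparr>on_obj = (\<lambda>X. X), on_hom = (\<lambda>X Y. dist_mult (Hom C X Y))\<rparr>"

definition convex_category ::
    "('o, 'm) cat \<Rightarrow> ('o, 'm \<Rightarrow> 'r::{comm_semiring_0, comm_monoid_mult}, 'o, 'm) ftor \<Rightarrow> bool" where
  "convex_category C \<pi> \<longleftrightarrow>
    category C \<and>
    is_functor (dist_cat C) C \<pi> \<and>
    functor_eq C (functor_comp \<pi> unit_functor) id_functor \<and>
    functor_eq (dist_cat (dist_cat C))
      (functor_comp \<pi> (dist_functor (dist_cat C) \<pi>))
      (functor_comp \<pi> (mult_functor C))"


section \<open>Simplicial sets\<close>

text \<open>
  \<open>\<Delta> m n\<close> is the set of morphisms \<open>[m] \<rightarrow> [n]\<close> of the simplex category, where \<open>[n] = {0, ..., n}\<close>.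
\<close>

definition \<Delta> :: "nat \<Rightarrow> nat \<Rightarrow> (nat \<Rightarrow> nat) set" where
  "\<Delta> m n = {\<theta> \<in> {..m} \<rightarrow>\<^sub>E {..n}. mono_on {..m} \<theta>}"

text \<open>
  A simplicial set is a contravariant functor from the simplex category to sets; \<open>act X m n \<theta>\<close> is
  the map \<open>X\<^sub>n \<rightarrow> X\<^sub>m\<close> induced by \<open>\<theta> : [m] \<rightarrow> [n]\<close>. The operators are required to be \<open>undefined\<close>
  outside their domain, so that equality in the type \<open>sset\<close> is equality of simplicial sets.
\<close>

record 'a sset =
  simplices :: "nat \<Rightarrow> 'a set"
  act :: "nat \<Rightarrow> nat \<Rightarrow> (nat \<Rightarrow> nat) \<Rightarrow> 'a \<Rightarrow> 'a"

definition simplicial_set :: "'a sset \<Rightarrow> bool" where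
  "simplicial_set X \<longleftrightarrow>
    (\<forall>m n. \<forall>\<theta> \<in> \<Delta> m n. act X m n \<theta> \<in> simplices X n \<rightarrow>\<^sub>E simplices X m) \<and>
    (\<forall>m n \<theta>. \<theta> \<notin> \<Delta> m n \<longrightarrow> act X m n \<theta> = undefined) \<and>
    (\<forall>n. \<forall>x \<in> simplices X n. act X n n (\<lambda>i\<in>{..n}. i) x = x) \<and>
    (\<forall>k m n. \<forall>\<theta> \<in> \<Delta> k m. \<forall>\<eta> \<in> \<Delta> m n. \<forall>x \<in> simplices X n.
      act X k n (compose {..k} \<eta> \<theta>) x = act X k m \<theta> (act X m n \<eta> x))"

definition sset_maps :: "'a sset \<Rightarrow> 'b sset \<Rightarrow> (nat \<Rightarrow> 'a \<Rightarrow> 'b) set" where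
  "sset_maps X Y = {f.
    (\<forall>n. f n \<in> simplices X n \<rightarrow>\<^sub>E simplices Y n) \<and>
    (\<forall>m n. \<forall>\<theta> \<in> \<Delta> m n. \<forall>x \<in> simplices X n. f m (act X m n \<theta> x) = act Y m n \<theta> (f n x))}"

definition sset_dist ::
    "'a sset \<Rightarrow> ('a \<Rightarrow> 'r::{comm_semiring_0, comm_monoid_mult}) sset" where
  "sset_dist X =
    \<lparr>simplices = (\<lambda>n. dist (simplices X n)),
     act = (\<lambda>m n \<theta>. if \<theta> \<in> \<Delta> m n
       then (\<lambda>p\<in>dist (simplices X n). dist_map (simplices X n) (act X m n \<theta>) p)
       else undefined)\<rparr>"

definition sset_delta ::
    "'a sset \<Rightarrow> nat \<Rightarrow> 'a \<Rightarrow> 'a \<Rightarrow> 'r::{comm_semiring_0, comm_monoid_mult}" where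
  "sset_delta X = (\<lambda>n. \<lambda>x\<in>simplices X n. delta x)"


section \<open>The Kleisli category\<close>

text \<open>
  The objects are the simplicial sets whose simplices are elements of the (arbitrary) type \<open>'a\<close>,
  which plays the role of the universe. Morphisms \<open>X \<rightarrow> Y\<close> are simplicial maps from \<open>X\<close> to
  \<open>sset_dist Y\<close>, whose simplices live in the type \<open>'a \<Rightarrow> 'r\<close>.
\<close>

definition kleisli ::
    "('a sset, nat \<Rightarrow> 'a \<Rightarrow> 'a \<Rightarrow> 'r::{comm_semiring_0, comm_monoid_mult}) cat" where
  "kleisli =
    \<lparr>Obj = {X. simplicial_set X},
     Hom = (\<lambda>X Y. sset_maps X (sset_dist Y)),
     Ident = sset_delta,
     Comp = (\<lambda>X Y Z q p. \<lambda>n. \<lambda>x\<in>simplices X n.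
       \<lambda>z. sum' (\<lambda>y. p n x y * q n y z) (simplices Y n))\<rparr>"

definition kleisli_convex ::
    "('a sset, (nat \<Rightarrow> 'a \<Rightarrow> 'a \<Rightarrow> 'r) \<Rightarrow> 'r::{comm_semiring_0, comm_monoid_mult},
      'a sset, nat \<Rightarrow> 'a \<Rightarrow> 'a \<Rightarrow> 'r) ftor" where
  "kleisli_convex =
    \<lparr>on_obj = (\<lambda>X. X),
     on_hom = (\<lambda>X Y Q. \<lambda>n. \<lambda>x\<in>simplices X n.
       \<lambda>y. sum' (\<lambda>p. Q p * p n x y) (sset_maps X (sset_dist Y)))\<rparr>"

end

theory Submission
  imports Defs
begin

text \<open>
  Every operation involved (the action of \<open>D\<^sub>R\<close> on maps, its multiplication, Kleisli composition,
  composition in \<open>D\<^sub>R(C)\<close>, and \<open>\<pi>\<close>) is an instance of the Kleisli extension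
  \<open>p \<mapsto> (t \<mapsto> \<Sum>\<^sub>s p s * k s t)\<close>. All required identities then follow from the
  monad laws of this extension together with its commutativity, i.e. the interchange of two
  independent finite sums. Commutativity of the monad is what makes composition in \<open>D\<^sub>R(C)\<close>
  compatible with Kleisli composition, and hence \<open>\<pi>\<close> a functor.
\<close>

section \<open>Kleisli extension of distributions\<close>

text \<open>The row vector \<open>p\<close> times the matrix \<open>k\<close>: entry
  \<open>k s t\<close> is the weight that the kernel at \<open>s\<close> gives to \<open>t\<close>.
  A kernel is any matrix, so that evaluation maps and intermediate expressions also qualify.\<close>

definition dist_bind ::
    "'a set \<Rightarrow> ('a \<Rightarrow> 'r::{comm_semiring_0, comm_monoid_mult}) \<Rightarrow> ('a \<Rightarrow> 'b \<Rightarrow> 'r) \<Rightarrow> 'b \<Rightarrow> 'r" where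
  "dist_bind S p k = (\<lambda>t. sum' (\<lambda>s. p s * k s t) S)"

text \<open>Bridge from \<open>sum'\<close> to ordinary finite sums. \<open>A\<close> may be any
  finite set containing the support, which later permits products and unions of supports as index
  sets.\<close>

lemma sum'_eq_sum:
  assumes "finite A" "A \<subseteq> S" "\<And>x. x \<in> S - A \<Longrightarrow> f x = 0"
  shows "sum' f S = sum f A"
proof -
  have "sum' f S = sum' f A"
    using assms by (intro sum.mono_neutral_right') auto
  then show ?thesis
    using assms(1) by (simp add: sum.eq_sum)
qed

text \<open>Because distributions are extended by zero, their support is a subset of
  \<open>S\<close> even when taken in the whole type; sums over it no longer mention
  \<open>S\<close>.\<close>

lemma distD:
  assumes "p \<in> dist S"
  shows "finite {s. p s \<noteq> 0}" "{s. p s \<noteq> 0} \<subseteq> S" "(\<Sum>s | p s \<noteq> 0. p s) = 1"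
proof -
  show sub: "{s. p s \<noteq> 0} \<subseteq> S"
    using assms by (auto simp: dist_def)
  then have "{s. p s \<noteq> 0} = {s \<in> S. p s \<noteq> 0}"
    by auto
  then show fin: "finite {s. p s \<noteq> 0}"
    using assms by (simp add: dist_def)
  have "sum' p S = (\<Sum>s | p s \<noteq> 0. p s)"
    using fin sub by (intro sum'_eq_sum) auto
  then show "(\<Sum>s | p s \<noteq> 0. p s) = 1"
    using assms by (simp add: dist_def)
qed

lemma dist_eq_0: "p \<in> dist S \<Longrightarrow> s \<notin> S \<Longrightarrow> p s = 0"
  by (simp add: dist_def)

lemma distI:
  assumes "finite A" "A \<subseteq> S" "\<And>s. s \<notin> A \<Longrightarrow> p s = 0" "sum p A = 1"
  shows "p \<in> dist S"
proof -
  have "finite {s \<in> S. p s \<noteq> 0}"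
    using assms(1,3) by (elim finite_subset[rotated]) auto
  moreover have "sum' p S = 1"
    using assms sum'_eq_sum[of A S p] by simp
  ultimately show ?thesis
    using assms by (auto simp: dist_def)
qed

text \<open>Terms with \<open>p s = 0\<close> vanish whatever the kernel is, so one finite index set
  serves all \<open>k\<close> and \<open>t\<close>. This makes interchanging sums
  legitimate.\<close>

lemma dist_bind_eq_sum:
  assumes "p \<in> dist S"
  shows "dist_bind S p k t = (\<Sum>s | p s \<noteq> 0. p s * k s t)"
  unfolding dist_bind_def using distD[OF assms] by (intro sum'_eq_sum) auto

text \<open>Only the values of a kernel on the base set matter. As a congruence rule this gives the
  simplifier membership in the base set while it rewrites a kernel.\<close>

lemma dist_bind_cong:
  assumes "S = S'" "p = p'" "\<And>s. s \<in> S' \<Longrightarrow> k s = k' s"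
  shows "dist_bind S p k = dist_bind S' p' k'"
  unfolding dist_bind_def assms(1,2) using assms(3) by (intro ext sum.cong') auto

section \<open>Unit laws, associativity and commutativity of the extension\<close>

lemma delta_in_dist: "s \<in> S \<Longrightarrow> delta s \<in> dist S"
  by (rule distI[of "{s}"]) (auto simp: delta_def)

text \<open>The support lies in the union \<open>?B\<close> of the supports of \<open>k s\<close>
  over the finitely many \<open>s\<close> with \<open>p s\<close> nonzero. Summing over
  \<open>?B\<close> first, each \<open>k s\<close> contributes total mass 1, which leaves the mass
  of \<open>p\<close>.\<close>

lemma dist_bind_in_dist:
  assumes p: "p \<in> dist S" and k: "\<And>s. s \<in> S \<Longrightarrow> k s \<in> dist T"
  shows "dist_bind S p k \<in> dist T"
proof (rule distI)
  let ?A = "{s. p s \<noteq> 0}"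
  let ?B = "\<Union>s \<in> ?A. {t. k s t \<noteq> 0}"
  note p' = distD[OF p]
  have kA: "k s \<in> dist T" if "s \<in> ?A" for s
    using that p'(2) k by blast
  show fin: "finite ?B"
    using p'(1) distD(1)[OF kA] by (rule finite_UN_I)
  show "?B \<subseteq> T"
    using distD(2)[OF kA] by (rule UN_least)
  show "dist_bind S p k t = 0" if "t \<notin> ?B" for t
    unfolding dist_bind_eq_sum[OF p] using that by (intro sum.neutral) auto
  have "sum (dist_bind S p k) ?B = (\<Sum>s\<in>?A. \<Sum>t\<in>?B. p s * k s t)"
    unfolding dist_bind_eq_sum[OF p] by (rule sum.swap)
  also have "\<dots> = (\<Sum>s\<in>?A. p s)"
  proof (rule sum.cong[OF refl])
    fix s assume s: "s \<in> ?A"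
    have "(\<Sum>t\<in>?B. k s t) = (\<Sum>t | k s t \<noteq> 0. k s t)"
      using s fin by (intro sum.mono_neutral_right) auto
    then show "(\<Sum>t\<in>?B. p s * k s t) = p s"
      using distD(3)[OF kA[OF s]] by (simp add: sum_distrib_left[symmetric])
  qed
  finally show "sum (dist_bind S p k) ?B = 1"
    using p'(3) by simp
qed

lemma dist_bind_delta_left:
  assumes "s \<in> S"
  shows "dist_bind S (delta s) k = k s"
proof
  fix t
  have "dist_bind S (delta s) k t = (\<Sum>u\<in>{s}. delta s u * k u t)"
    unfolding dist_bind_def using assms by (intro sum'_eq_sum) (auto simp: delta_def)
  then show "dist_bind S (delta s) k t = k s t"
    by (simp add: delta_def)
qed

text \<open>For \<open>t\<close> in \<open>S\<close> only the term \<open>s = t\<close> survives;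
  outside \<open>S\<close> both sides are 0 because elements of \<open>dist S\<close> vanish
  there.\<close>

lemma dist_bind_delta_right:
  assumes "p \<in> dist S"
  shows "dist_bind S p delta = p"
proof
  fix t
  show "dist_bind S p delta t = p t"
  proof (cases "t \<in> S")
    case True
    then have "dist_bind S p delta t = (\<Sum>s\<in>{t}. p s * delta s t)"
      unfolding dist_bind_def by (intro sum'_eq_sum) (auto simp: delta_def)
    then show ?thesis
      by (simp add: delta_def)
  next
    case False
    moreover have "dist_bind S p delta \<in> dist S"
      using assms delta_in_dist by (rule dist_bind_in_dist)
    ultimately show ?thesis
      using assms by (simp add: dist_eq_0)
  qed
qed

text \<open>Associativity of matrix multiplication. The union \<open>?B\<close> is a finite index
  set common to all relevant \<open>k s\<close>, so the double sum can be swapped and each inner sum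
  then shrunk to the support of its own \<open>k s\<close>.\<close>

lemma dist_bind_assoc:
  assumes p: "p \<in> dist S" and k: "\<And>s. s \<in> S \<Longrightarrow> k s \<in> dist T"
  shows "dist_bind T (dist_bind S p k) l = dist_bind S p (\<lambda>s. dist_bind T (k s) l)"
proof
  fix u
  let ?A = "{s. p s \<noteq> 0}"
  let ?B = "\<Union>s \<in> ?A. {t. k s t \<noteq> 0}"
  note p' = distD[OF p]
  have kA: "k s \<in> dist T" if "s \<in> ?A" for s
    using that p'(2) k by blast
  have fin: "finite ?B"
    using p'(1) distD(1)[OF kA] by (rule finite_UN_I)
  have sub: "?B \<subseteq> T"
    using distD(2)[OF kA] by (rule UN_least)
  have out: "dist_bind S p k t = 0" if "t \<notin> ?B" for t
    unfolding dist_bind_eq_sum[OF p] using that by (intro sum.neutral) auto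
  have "dist_bind T (dist_bind S p k) l u = (\<Sum>t\<in>?B. dist_bind S p k t * l t u)"
    unfolding dist_bind_def[of T] using fin sub out by (intro sum'_eq_sum) auto
  also have "\<dots> = (\<Sum>t\<in>?B. \<Sum>s\<in>?A. p s * (k s t * l t u))"
    unfolding dist_bind_eq_sum[OF p] by (simp add: sum_distrib_right mult.assoc)
  also have "\<dots> = (\<Sum>s\<in>?A. \<Sum>t\<in>?B. p s * (k s t * l t u))"
    by (rule sum.swap)
  also have "\<dots> = (\<Sum>s\<in>?A. p s * dist_bind T (k s) l u)"
  proof (rule sum.cong[OF refl])
    fix s assume s: "s \<in> ?A"
    have "dist_bind T (k s) l u = (\<Sum>t\<in>?B. k s t * l t u)"
      unfolding dist_bind_eq_sum[OF kA[OF s]] using s fin by (intro sum.mono_neutral_left) auto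
    then show "(\<Sum>t\<in>?B. p s * (k s t * l t u)) = p s * dist_bind T (k s) l u"
      by (simp add: sum_distrib_left)
  qed
  finally show "dist_bind T (dist_bind S p k) l u = dist_bind S p (\<lambda>s. dist_bind T (k s) l) u"
    by (simp add: dist_bind_eq_sum[OF p])
qed

text \<open>Fubini for two finite supports, neither depending on the other variable; commutativity
  of the coefficients exchanges the weights \<open>p s\<close> and \<open>q t\<close>.\<close>

lemma dist_bind_commute:
  assumes p: "p \<in> dist S" and q: "q \<in> dist T"
  shows "dist_bind S p (\<lambda>s. dist_bind T q (k s)) = dist_bind T q (\<lambda>t. dist_bind S p (\<lambda>s. k s t))"
proof
  fix u
  have "dist_bind S p (\<lambda>s. dist_bind T q (k s)) u
      = (\<Sum>s | p s \<noteq> 0. \<Sum>t | q t \<noteq> 0. p s * (q t * k s t u))"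
    unfolding dist_bind_eq_sum[OF p] dist_bind_eq_sum[OF q] by (simp add: sum_distrib_left)
  also have "\<dots> = (\<Sum>t | q t \<noteq> 0. \<Sum>s | p s \<noteq> 0. q t * (p s * k s t u))"
    by (subst sum.swap) (simp add: mult.left_commute)
  also have "\<dots> = dist_bind T q (\<lambda>t. dist_bind S p (\<lambda>s. k s t)) u"
    unfolding dist_bind_eq_sum[OF p] dist_bind_eq_sum[OF q] by (simp add: sum_distrib_left)
  finally show "dist_bind S p (\<lambda>s. dist_bind T q (k s)) u
      = dist_bind T q (\<lambda>t. dist_bind S p (\<lambda>s. k s t)) u" .
qed

text \<open>The fibre condition \<open>f s = t\<close> turns into the factor
  \<open>delta (f s) t\<close>, so pushforward inherits the laws of the extension.\<close>

lemma dist_map_eq_bind: "dist_map S f p = dist_bind S p (\<lambda>s. delta (f s))"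
proof
  fix t
  have "sum' p {s \<in> S. f s = t} = sum' (\<lambda>s. p s * delta (f s) t) {s \<in> S. f s = t}"
    by (rule sum.cong') (auto simp: delta_def)
  also have "\<dots> = sum' (\<lambda>s. p s * delta (f s) t) S"
    by (rule sum.mono_neutral_left') (auto simp: delta_def)
  finally show "dist_map S f p t = dist_bind S p (\<lambda>s. delta (f s)) t"
    by (simp add: dist_map_def dist_bind_def)
qed

lemma dist_map_in_dist:
  assumes "p \<in> dist S" "\<And>s. s \<in> S \<Longrightarrow> f s \<in> T"
  shows "dist_map S f p \<in> dist T"
  unfolding dist_map_eq_bind using assms by (intro dist_bind_in_dist delta_in_dist) auto

text \<open>Change of variables: associativity followed by the left unit law.\<close>

lemma dist_bind_dist_map:
  assumes "p \<in> dist S" "\<And>s. s \<in> S \<Longrightarrow> f s \<in> T"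
  shows "dist_bind T (dist_map S f p) k = dist_bind S p (\<lambda>s. k (f s))"
proof -
  have "dist_bind T (dist_map S f p) k = dist_bind S p (\<lambda>s. dist_bind T (delta (f s)) k)"
    unfolding dist_map_eq_bind using assms by (intro dist_bind_assoc delta_in_dist) auto
  also have "\<dots> = dist_bind S p (\<lambda>s. k (f s))"
    using assms by (intro dist_bind_cong dist_bind_delta_left) auto
  finally show ?thesis .
qed

lemma dist_map_dist_bind:
  assumes "p \<in> dist S" "\<And>s. s \<in> S \<Longrightarrow> k s \<in> dist T"
  shows "dist_map T f (dist_bind S p k) = dist_bind S p (\<lambda>s. dist_map T f (k s))"
  unfolding dist_map_eq_bind using assms by (rule dist_bind_assoc)

lemma dist_mult_eq_bind: "dist_mult S P = dist_bind (dist S) P (\<lambda>p. p)"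
  by (simp add: dist_mult_def dist_bind_def)


section \<open>The category of distributions\<close>

lemma dist_cat_simps [simp]:
  "Obj (dist_cat C) = Obj C"
  "Hom (dist_cat C) X Y = dist (Hom C X Y)"
  "Ident (dist_cat C) X = delta (Ident C X)"
  by (simp_all add: dist_cat_def)

text \<open>The convolution sum lives on the product of two finite supports and hence splits into an
  iterated sum, here with \<open>q\<close> outermost.\<close>

lemma dist_cat_Comp:
  assumes q: "q \<in> dist (Hom C Y Z)" and p: "p \<in> dist (Hom C X Y)"
  shows "Comp (dist_cat C) X Y Z q p =
    dist_bind (Hom C Y Z) q (\<lambda>g. dist_map (Hom C X Y) (Comp C X Y Z g) p)"
proof
  fix f
  let ?A = "{g. q g \<noteq> 0} \<times> {h. p h \<noteq> 0}"
  let ?S = "{(g, h). g \<in> Hom C Y Z \<and> h \<in> Hom C X Y \<and> Comp C X Y Z g h = f}"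
  note q' = distD[OF q] and p' = distD[OF p]
  let ?w = "\<lambda>(g, h). q g * (p h * delta (Comp C X Y Z g h) f)"
  have fin: "finite ?A"
    using q'(1) p'(1) by simp
  have "Comp (dist_cat C) X Y Z q p f = sum' (\<lambda>(g, h). q g * p h) ?S"
    by (simp add: dist_cat_def)
  \<comment> \<open>The \<open>delta\<close> factor is 1 on the fibre over \<open>f\<close> and 0
    off it; once inserted, it lets the sum range over all pairs.\<close>
  also have "\<dots> = sum' ?w ?S"
    by (rule sum.cong') (auto simp: delta_def)
  also have "\<dots> = sum' ?w (Hom C Y Z \<times> Hom C X Y)"
    by (rule sum.mono_neutral_left') (auto simp: delta_def split: if_splits)
  also have "\<dots> = sum ?w ?A"
    using q'(2) p'(2) fin by (intro sum'_eq_sum) auto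
  also have "\<dots> = (\<Sum>g | q g \<noteq> 0. q g * (\<Sum>h | p h \<noteq> 0. p h * delta (Comp C X Y Z g h) f))"
    by (simp add: sum.cartesian_product sum_distrib_left)
  finally show "Comp (dist_cat C) X Y Z q p f =
      dist_bind (Hom C Y Z) q (\<lambda>g. dist_map (Hom C X Y) (Comp C X Y Z g) p) f"
    by (simp add: dist_map_eq_bind dist_bind_eq_sum[OF q] dist_bind_eq_sum[OF p])
qed

lemma dist_cat_Comp_in_dist:
  assumes C: "category C" and X: "X \<in> Obj C" "Y \<in> Obj C" "Z \<in> Obj C"
    and q: "q \<in> dist (Hom C Y Z)" and p: "p \<in> dist (Hom C X Y)"
  shows "Comp (dist_cat C) X Y Z q p \<in> dist (Hom C X Z)"
  unfolding dist_cat_Comp[OF q p]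
  using C X by (intro dist_bind_in_dist[OF q] dist_map_in_dist[OF p]) (simp add: category_def)

text \<open>Computation rule for extending along a convolution. With pushforward kernels it yields
  associativity in \<open>dist_cat\<close>, with evaluation kernels the functoriality of
  \<pi>.\<close>

lemma dist_bind_dist_cat_Comp:
  assumes C: "category C" and X: "X \<in> Obj C" "Y \<in> Obj C" "Z \<in> Obj C"
    and q: "q \<in> dist (Hom C Y Z)" and p: "p \<in> dist (Hom C X Y)"
  shows "dist_bind (Hom C X Z) (Comp (dist_cat C) X Y Z q p) k =
    dist_bind (Hom C Y Z) q (\<lambda>g. dist_bind (Hom C X Y) p (\<lambda>f. k (Comp C X Y Z g f)))"
proof -
  have in_Hom: "Comp C X Y Z g f \<in> Hom C X Z" if "g \<in> Hom C Y Z" "f \<in> Hom C X Y" for g f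
    using C X that by (simp add: category_def)
  have "dist_bind (Hom C X Z) (Comp (dist_cat C) X Y Z q p) k =
      dist_bind (Hom C Y Z) q
        (\<lambda>g. dist_bind (Hom C X Z) (dist_map (Hom C X Y) (Comp C X Y Z g) p) k)"
    unfolding dist_cat_Comp[OF q p] using in_Hom
    by (intro dist_bind_assoc[OF q] dist_map_in_dist[OF p])
  also have "\<dots> = dist_bind (Hom C Y Z) q
      (\<lambda>g. dist_bind (Hom C X Y) p (\<lambda>f. k (Comp C X Y Z g f)))"
    using in_Hom by (intro dist_bind_cong dist_bind_dist_map[OF p]) auto
  finally show ?thesis .
qed

text \<open>Both unit laws collapse to the right unit law of the extension. For associativity, both
  bracketings expand into extensions nested in the order \<open>h\<close>, \<open>g\<close>,
  \<open>f\<close>, and associativity in \<open>C\<close> identifies the innermost terms.\<close>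

lemma category_dist_cat:
  fixes C :: "('o, 'm) cat"
  assumes C: "category C"
  shows "category (dist_cat C :: ('o, 'm \<Rightarrow> 'r::{comm_semiring_0, comm_monoid_mult}) cat)"
proof -
  let ?D = "dist_cat C :: ('o, 'm \<Rightarrow> 'r) cat"
  have id_in: "Ident C X \<in> Hom C X X" if "X \<in> Obj C" for X
    using C that by (simp add: category_def)
  have id_l: "Comp C X Y Y (Ident C Y) f = f" and id_r: "Comp C X X Y f (Ident C X) = f"
    if "X \<in> Obj C" "Y \<in> Obj C" "f \<in> Hom C X Y" for X Y f
    using C that by (simp_all add: category_def)
  have assoc: "Comp C W X Z (Comp C X Y Z h g) f = Comp C W Y Z h (Comp C W X Y g f)"
    if "W \<in> Obj C" "X \<in> Obj C" "Y \<in> Obj C" "Z \<in> Obj C"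
      "h \<in> Hom C Y Z" "g \<in> Hom C X Y" "f \<in> Hom C W X" for W X Y Z h g f
    using C that by (simp add: category_def)
  have "Comp ?D X X Y f (delta (Ident C X)) = f"
    if X: "X \<in> Obj C" "Y \<in> Obj C" and f: "f \<in> dist (Hom C X Y)" for X Y f
  proof -
    have "Comp ?D X X Y f (delta (Ident C X)) = dist_bind (Hom C X Y) f delta"
      unfolding dist_cat_Comp[OF f delta_in_dist[OF id_in[OF X(1)]]]
      using X id_in
      by (intro dist_bind_cong) (auto simp: dist_map_eq_bind dist_bind_delta_left id_r)
    then show ?thesis
      using f by (simp add: dist_bind_delta_right)
  qed
  moreover have "Comp ?D X Y Y (delta (Ident C Y)) f = f"
    if X: "X \<in> Obj C" "Y \<in> Obj C" and f: "f \<in> dist (Hom C X Y)" for X Y f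
  proof -
    have "Comp ?D X Y Y (delta (Ident C Y)) f = dist_bind (Hom C X Y) f delta"
      unfolding dist_cat_Comp[OF delta_in_dist[OF id_in[OF X(2)]] f]
        dist_bind_delta_left[OF id_in[OF X(2)]] dist_map_eq_bind
      using X by (intro dist_bind_cong) (auto simp: id_l)
    then show ?thesis
      using f by (simp add: dist_bind_delta_right)
  qed
  moreover have "Comp ?D W X Z (Comp ?D X Y Z h g) f = Comp ?D W Y Z h (Comp ?D W X Y g f)"
    if W: "W \<in> Obj C" "X \<in> Obj C" "Y \<in> Obj C" "Z \<in> Obj C"
      and h: "h \<in> dist (Hom C Y Z)" and g: "g \<in> dist (Hom C X Y)" and f: "f \<in> dist (Hom C W X)"
    for W X Y Z h g f
  proof -
    have hg: "Comp ?D X Y Z h g \<in> dist (Hom C X Z)" and gf: "Comp ?D W X Y g f \<in> dist (Hom C W Y)"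
      using C W h g f by (auto intro: dist_cat_Comp_in_dist)
    have "Comp ?D W X Z (Comp ?D X Y Z h g) f =
        dist_bind (Hom C Y Z) h (\<lambda>h'. dist_bind (Hom C X Y) g (\<lambda>g'.
          dist_map (Hom C W X) (Comp C W X Z (Comp C X Y Z h' g')) f))"
      unfolding dist_cat_Comp[OF hg f] using C W h g by (simp add: dist_bind_dist_cat_Comp)
    also have "\<dots> = dist_bind (Hom C Y Z) h (\<lambda>h'. dist_map (Hom C W Y) (Comp C W Y Z h')
        (Comp ?D W X Y g f))"
      unfolding dist_map_eq_bind
      using C W g f assoc by (simp add: dist_bind_dist_cat_Comp cong: dist_bind_cong)
    also have "\<dots> = Comp ?D W Y Z h (Comp ?D W X Y g f)"
      by (rule dist_cat_Comp[OF h gf, symmetric])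
    finally show ?thesis .
  qed
  ultimately show ?thesis
    unfolding category_def[of ?D] dist_cat_simps
    using C by (auto intro: dist_cat_Comp_in_dist delta_in_dist id_in)
qed


section \<open>The Kleisli category\<close>

text \<open>The third fact removes the restriction built into \<open>act (sset_dist Y)\<close>,
  which is harmless since \<open>p n x\<close> lies in its domain.\<close>

lemma sset_mapsD:
  assumes "p \<in> sset_maps X (sset_dist Y)"
  shows "x \<in> simplices X n \<Longrightarrow> p n x \<in> dist (simplices Y n)"
    and "p n \<in> extensional (simplices X n)"
    and "\<theta> \<in> \<Delta> m n \<Longrightarrow> x \<in> simplices X n \<Longrightarrow>
      p m (act X m n \<theta> x) = dist_map (simplices Y n) (act Y m n \<theta>) (p n x)"
proof -
  have p: "p n \<in> simplices X n \<rightarrow>\<^sub>E dist (simplices Y n)" for n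
    using assms by (simp add: sset_maps_def sset_dist_def)
  then show in_dist: "x \<in> simplices X n \<Longrightarrow> p n x \<in> dist (simplices Y n)"
    by blast
  show "p n \<in> extensional (simplices X n)"
    using p[of n] by (simp add: PiE_def)
  show "p m (act X m n \<theta> x) = dist_map (simplices Y n) (act Y m n \<theta>) (p n x)"
    if "\<theta> \<in> \<Delta> m n" "x \<in> simplices X n"
  proof -
    have "p m (act X m n \<theta> x) = act (sset_dist Y) m n \<theta> (p n x)"
      using assms that by (simp add: sset_maps_def)
    then show ?thesis
      using that p[of n] by (auto simp: sset_dist_def)
  qed
qed

lemma sset_mapsI:
  assumes "\<And>n x. x \<in> simplices X n \<Longrightarrow> p n x \<in> dist (simplices Y n)"
    and "\<And>n. p n \<in> extensional (simplices X n)"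
    and "\<And>m n \<theta> x. \<theta> \<in> \<Delta> m n \<Longrightarrow> x \<in> simplices X n \<Longrightarrow>
      p m (act X m n \<theta> x) = dist_map (simplices Y n) (act Y m n \<theta>) (p n x)"
  shows "p \<in> sset_maps X (sset_dist Y)"
  using assms by (auto simp: sset_maps_def sset_dist_def PiE_def)

text \<open>Both maps are \<open>undefined\<close> off the simplices, so agreement on simplices is
  equality.\<close>

lemma sset_maps_eqI:
  assumes "p \<in> sset_maps X (sset_dist Y)" "q \<in> sset_maps X (sset_dist Y)"
    and "\<And>n x. x \<in> simplices X n \<Longrightarrow> p n x = q n x"
  shows "p = q"
proof
  fix n
  show "p n = q n"
    using sset_mapsD(2)[OF assms(1)] sset_mapsD(2)[OF assms(2)] assms(3)
    by (rule extensionalityI)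
qed

lemma act_in_simplices:
  assumes "simplicial_set X" "\<theta> \<in> \<Delta> m n" "x \<in> simplices X n"
  shows "act X m n \<theta> x \<in> simplices X m"
proof -
  have "act X m n \<theta> \<in> simplices X n \<rightarrow>\<^sub>E simplices X m"
    using assms(1,2) by (simp add: simplicial_set_def)
  then show ?thesis
    using assms(3) by blast
qed

section \<open>Identities and composition of Kleisli maps\<close>

lemma kleisli_simps [simp]:
  "Obj kleisli = {X. simplicial_set X}"
  "Hom kleisli X Y = sset_maps X (sset_dist Y)"
  "Ident kleisli X = sset_delta X"
  by (simp_all add: kleisli_def)

text \<open>Here \<open>p\<close> is the distribution and \<open>q\<close> the kernel, the reverse
  of the nesting in \<open>dist_cat_Comp\<close>; this mismatch is where commutativity enters
  later.\<close>

lemma kleisli_Comp: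
  "Comp kleisli X Y Z q p =
    (\<lambda>n. \<lambda>x\<in>simplices X n. dist_bind (simplices Y n) (p n x) (q n))"
  by (simp add: kleisli_def dist_bind_def)

lemma sset_delta_in_sset_maps:
  assumes "simplicial_set X"
  shows "sset_delta X \<in> sset_maps X (sset_dist X)"
  using assms
  by (intro sset_mapsI)
    (auto simp: sset_delta_def delta_in_dist act_in_simplices dist_map_eq_bind dist_bind_delta_left)

text \<open>Naturality: that of \<open>p\<close> turns the simplicial operator into a pushforward, a
  change of variables moves it into the argument of \<open>q\<close>, and naturality of
  \<open>q\<close> moves it outside.\<close>

lemma kleisli_Comp_in_sset_maps:
  assumes X: "simplicial_set X" and Y: "simplicial_set Y"
    and q: "q \<in> sset_maps Y (sset_dist Z)" and p: "p \<in> sset_maps X (sset_dist Y)"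
  shows "Comp kleisli X Y Z q p \<in> sset_maps X (sset_dist Z)"
proof (rule sset_mapsI)
  note q' = sset_mapsD[OF q] and p' = sset_mapsD[OF p]
  show "Comp kleisli X Y Z q p n x \<in> dist (simplices Z n)" if "x \<in> simplices X n" for n x
    using that p'(1) q'(1) by (auto simp: kleisli_Comp intro!: dist_bind_in_dist)
  show "Comp kleisli X Y Z q p n \<in> extensional (simplices X n)" for n
    by (simp add: kleisli_Comp)
  fix m n \<theta> x assume \<theta>: "\<theta> \<in> \<Delta> m n" and x: "x \<in> simplices X n"
  have "Comp kleisli X Y Z q p m (act X m n \<theta> x) =
      dist_bind (simplices Y m) (dist_map (simplices Y n) (act Y m n \<theta>) (p n x)) (q m)"
    using X \<theta> x by (simp add: kleisli_Comp act_in_simplices p'(3))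
  also have "\<dots> = dist_bind (simplices Y n) (p n x) (\<lambda>y. q m (act Y m n \<theta> y))"
    using Y \<theta> p'(1)[OF x] by (intro dist_bind_dist_map) (auto simp: act_in_simplices)
  also have "\<dots> = dist_bind (simplices Y n) (p n x)
      (\<lambda>y. dist_map (simplices Z n) (act Z m n \<theta>) (q n y))"
    using \<theta> by (intro dist_bind_cong) (auto simp: q'(3))
  also have "\<dots> = dist_map (simplices Z n) (act Z m n \<theta>) (Comp kleisli X Y Z q p n x)"
    using x q'(1) by (simp add: kleisli_Comp dist_map_dist_bind[OF p'(1)[OF x]])
  finally show "Comp kleisli X Y Z q p m (act X m n \<theta> x) =
    dist_map (simplices Z n) (act Z m n \<theta>) (Comp kleisli X Y Z q p n x)" .
qed

lemma category_kleisli: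
  "category (kleisli ::
    ('a sset, nat \<Rightarrow> 'a \<Rightarrow> 'a \<Rightarrow> 'r::{comm_semiring_0, comm_monoid_mult}) cat)"
proof -
  let ?K = "kleisli :: ('a sset, nat \<Rightarrow> 'a \<Rightarrow> 'a \<Rightarrow> 'r) cat"
  have "Comp ?K X X Y f (sset_delta X) = f"
    if "simplicial_set X" "simplicial_set Y" and f: "f \<in> sset_maps X (sset_dist Y)" for X Y f
  proof (rule sset_maps_eqI[OF kleisli_Comp_in_sset_maps f])
    fix n x assume x: "x \<in> simplices X n"
    then show "Comp ?K X X Y f (sset_delta X) n x = f n x"
      by (simp add: kleisli_Comp sset_delta_def dist_bind_delta_left)
  qed (use that in \<open>auto simp: sset_delta_in_sset_maps\<close>)
  moreover have "Comp ?K X Y Y (sset_delta Y) f = f"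
    if "simplicial_set X" "simplicial_set Y" and f: "f \<in> sset_maps X (sset_dist Y)" for X Y f
  proof (rule sset_maps_eqI[OF kleisli_Comp_in_sset_maps f])
    fix n x assume x: "x \<in> simplices X n"
    \<comment> \<open>\<open>sset_delta\<close> is cut off outside the simplices, where the
      extension never evaluates its kernel.\<close>
    have "dist_bind (simplices Y n) (f n x) (sset_delta Y n) = dist_bind (simplices Y n) (f n x) delta"
      by (rule dist_bind_cong) (auto simp: sset_delta_def)
    then show "Comp ?K X Y Y (sset_delta Y) f n x = f n x"
      using x sset_mapsD(1)[OF f x] by (simp add: kleisli_Comp dist_bind_delta_right)
  qed (use that in \<open>auto simp: sset_delta_in_sset_maps\<close>)
  moreover have "Comp ?K W X Z (Comp ?K X Y Z h g) f = Comp ?K W Y Z h (Comp ?K W X Y g f)"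
    if W: "simplicial_set W" "simplicial_set X" "simplicial_set Y" "simplicial_set Z"
      and h: "h \<in> sset_maps Y (sset_dist Z)" and g: "g \<in> sset_maps X (sset_dist Y)"
      and f: "f \<in> sset_maps W (sset_dist X)" for W X Y Z h g f
  proof (rule sset_maps_eqI)
    show "Comp ?K W X Z (Comp ?K X Y Z h g) f \<in> sset_maps W (sset_dist Z)"
      "Comp ?K W Y Z h (Comp ?K W X Y g f) \<in> sset_maps W (sset_dist Z)"
      using that by (auto intro!: kleisli_Comp_in_sset_maps)
    fix n x assume x: "x \<in> simplices W n"
    show "Comp ?K W X Z (Comp ?K X Y Z h g) f n x = Comp ?K W Y Z h (Comp ?K W X Y g f) n x"
      using x dist_bind_assoc[OF sset_mapsD(1)[OF f x], where k = "g n" and l = "h n",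
          OF sset_mapsD(1)[OF g]]
      by (simp add: kleisli_Comp cong: dist_bind_cong)
  qed
  ultimately show ?thesis
    unfolding category_def kleisli_simps
    by (auto intro: sset_delta_in_sset_maps kleisli_Comp_in_sset_maps)
qed


section \<open>The convex structure\<close>

text \<open>At a simplex \<open>x\<close>, \<pi> is the extension of \<open>Q\<close> along
  evaluation at \<open>x\<close>.\<close>

lemma kleisli_convex_simps [simp]:
  "on_obj kleisli_convex X = X"
  "on_hom kleisli_convex X Y Q =
    (\<lambda>n. \<lambda>x\<in>simplices X n. dist_bind (sset_maps X (sset_dist Y)) Q (\<lambda>p. p n x))"
  by (simp_all add: kleisli_convex_def dist_bind_def)

text \<open>Pushforward along a simplicial operator is linear, so it commutes with the convex
  combination given by \<open>Q\<close>.\<close>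

lemma kleisli_convex_in_sset_maps:
  assumes X: "simplicial_set X" and Q: "Q \<in> dist (sset_maps X (sset_dist Y))"
  shows "on_hom kleisli_convex X Y Q \<in> sset_maps X (sset_dist Y)"
proof (rule sset_mapsI)
  let ?H = "sset_maps X (sset_dist Y)"
  show "on_hom kleisli_convex X Y Q n x \<in> dist (simplices Y n)" if "x \<in> simplices X n" for n x
    using that Q by (auto intro: dist_bind_in_dist[OF Q] sset_mapsD(1))
  show "on_hom kleisli_convex X Y Q n \<in> extensional (simplices X n)" for n
    by simp
  fix m n \<theta> x assume \<theta>: "\<theta> \<in> \<Delta> m n" and x: "x \<in> simplices X n"
  have "on_hom kleisli_convex X Y Q m (act X m n \<theta> x) =
      dist_bind ?H Q (\<lambda>p. p m (act X m n \<theta> x))"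
    using X \<theta> x by (simp add: act_in_simplices)
  also have "\<dots> = dist_bind ?H Q (\<lambda>p. dist_map (simplices Y n) (act Y m n \<theta>) (p n x))"
    using \<theta> x by (intro dist_bind_cong) (auto simp: sset_mapsD(3))
  also have "\<dots> = dist_map (simplices Y n) (act Y m n \<theta>) (dist_bind ?H Q (\<lambda>p. p n x))"
    using x by (intro dist_map_dist_bind[symmetric] Q) (auto intro: sset_mapsD(1))
  finally show "on_hom kleisli_convex X Y Q m (act X m n \<theta> x) =
      dist_map (simplices Y n) (act Y m n \<theta>) (on_hom kleisli_convex X Y Q n x)"
    using x by simp
qed

lemma kleisli_convex_delta:
  assumes "f \<in> sset_maps X (sset_dist Y)"
  shows "on_hom kleisli_convex X Y (delta f) = f"
  by (simp add: dist_bind_delta_left[OF assms] extensional_restrict[OF sset_mapsD(2)[OF assms]])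

lemma kleisli_convex_Comp:
  assumes X: "simplicial_set X" "simplicial_set Y" "simplicial_set Z"
    and q: "q \<in> dist (sset_maps Y (sset_dist Z))" and p: "p \<in> dist (sset_maps X (sset_dist Y))"
  shows "on_hom kleisli_convex X Z (Comp (dist_cat kleisli) X Y Z q p) =
    Comp kleisli X Y Z (on_hom kleisli_convex Y Z q) (on_hom kleisli_convex X Y p)"
proof (rule sset_maps_eqI)
  let ?H = "sset_maps X (sset_dist Y)" and ?G = "sset_maps Y (sset_dist Z)"
  let ?qp = "Comp (dist_cat kleisli) X Y Z q p"
  have "?qp \<in> dist (Hom kleisli X Z)"
    using X q p by (intro dist_cat_Comp_in_dist category_kleisli) auto
  then show "on_hom kleisli_convex X Z ?qp \<in> sset_maps X (sset_dist Z)"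
    using X by (intro kleisli_convex_in_sset_maps) auto
  show "Comp kleisli X Y Z (on_hom kleisli_convex Y Z q) (on_hom kleisli_convex X Y p)
      \<in> sset_maps X (sset_dist Z)"
    using X q p by (intro kleisli_Comp_in_sset_maps kleisli_convex_in_sset_maps)
  fix n x assume x: "x \<in> simplices X n"
  have "on_hom kleisli_convex X Z ?qp n x =
      dist_bind ?G q (\<lambda>g. dist_bind ?H p (\<lambda>f. dist_bind (simplices Y n) (f n x) (g n)))"
    \<comment> \<open>The kernel is evaluation at \<open>x\<close>, under which a composite of
      \<open>f\<close> and \<open>g\<close> becomes the extension of \<open>f n x\<close> along
      \<open>g n\<close>.\<close>
    using x X q p dist_bind_dist_cat_Comp[OF category_kleisli, of X Y Z q p "\<lambda>h. h n x"]
    by (simp add: kleisli_Comp)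
  \<comment> \<open>\<open>q\<close> must become innermost: it is interchanged first with
    \<open>p\<close>, then with the distribution \<open>f n x\<close>.\<close>
  also have "\<dots> = dist_bind ?H p (\<lambda>f. dist_bind ?G q (\<lambda>g. dist_bind (simplices Y n) (f n x) (g n)))"
    by (rule dist_bind_commute[OF q p])
  also have "\<dots> = dist_bind ?H p (\<lambda>f. dist_bind (simplices Y n) (f n x)
      (\<lambda>y. dist_bind ?G q (\<lambda>g. g n y)))"
    using x by (intro dist_bind_cong refl dist_bind_commute[OF q]) (rule sset_mapsD(1))
  also have "\<dots> = dist_bind (simplices Y n) (dist_bind ?H p (\<lambda>f. f n x))
      (\<lambda>y. dist_bind ?G q (\<lambda>g. g n y))"
    using x by (intro dist_bind_assoc[symmetric] p) (rule sset_mapsD(1))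
  also have "\<dots> = Comp kleisli X Y Z (on_hom kleisli_convex Y Z q) (on_hom kleisli_convex X Y p) n x"
    using x by (simp add: kleisli_Comp cong: dist_bind_cong)
  finally show "on_hom kleisli_convex X Z ?qp n x =
    Comp kleisli X Y Z (on_hom kleisli_convex Y Z q) (on_hom kleisli_convex X Y p) n x" .
qed

text \<open>The multiplication is the extension along the identity kernel, so at each simplex the
  claim is associativity with evaluation as last kernel.\<close>

lemma kleisli_convex_dist_mult:
  assumes X: "simplicial_set X" and P: "P \<in> dist (dist (sset_maps X (sset_dist Y)))"
  shows "on_hom kleisli_convex X Y
      (dist_map (dist (sset_maps X (sset_dist Y))) (on_hom kleisli_convex X Y) P) =
    on_hom kleisli_convex X Y (dist_mult (sset_maps X (sset_dist Y)) P)"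
proof -
  let ?H = "sset_maps X (sset_dist Y)"
  let ?P = "dist_map (dist ?H) (on_hom kleisli_convex X Y) P"
  have "dist_bind ?H ?P (\<lambda>p. p n x) = dist_bind ?H (dist_mult ?H P) (\<lambda>p. p n x)"
    if x: "x \<in> simplices X n" for n x
  proof -
    have "dist_bind ?H ?P (\<lambda>p. p n x) =
        dist_bind (dist ?H) P (\<lambda>Q. on_hom kleisli_convex X Y Q n x)"
      by (intro dist_bind_dist_map P kleisli_convex_in_sset_maps X)
    also have "\<dots> = dist_bind (dist ?H) P (\<lambda>Q. dist_bind ?H Q (\<lambda>p. p n x))"
      using x by simp
    also have "\<dots> = dist_bind ?H (dist_mult ?H P) (\<lambda>p. p n x)"
      unfolding dist_mult_eq_bind by (rule dist_bind_assoc[OF P, symmetric])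
    finally show ?thesis .
  qed
  then show ?thesis
    unfolding kleisli_convex_simps(2)[of X Y ?P] kleisli_convex_simps(2)[of X Y "dist_mult ?H P"]
    \<comment> \<open>The type instance confines \<open>ext\<close> to the degree \<open>n\<close>;
      equality in \<open>x\<close> is left to \<open>restrict_ext\<close>, which asks for it on
      simplices only.\<close>
    by (intro ext[where 'a = nat] restrict_ext)
qed

theorem proposition3p13:
  shows "convex_category
    (kleisli :: ('a sset, nat \<Rightarrow> 'a \<Rightarrow> 'a \<Rightarrow> 'r::{comm_semiring_0, comm_monoid_mult}) cat)
    kleisli_convex"
proof -
  let ?K = "kleisli :: ('a sset, nat \<Rightarrow> 'a \<Rightarrow> 'a \<Rightarrow> 'r) cat"
  have "is_functor (dist_cat ?K) ?K kleisli_convex"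
    unfolding is_functor_def dist_cat_simps kleisli_simps kleisli_convex_simps(1)
    using category_kleisli category_dist_cat[OF category_kleisli]
    \<comment> \<open>\<open>on_hom kleisli_convex\<close> stays folded so that the lemmas about it
      match.\<close>
    by (auto simp del: kleisli_convex_simps(2)
        intro: kleisli_convex_in_sset_maps kleisli_convex_delta kleisli_convex_Comp
          sset_delta_in_sset_maps)
  moreover have "functor_eq ?K (functor_comp kleisli_convex unit_functor) id_functor"
    by (auto simp: functor_eq_def functor_comp_def unit_functor_def id_functor_def
        kleisli_convex_delta simp del: kleisli_convex_simps(2))
  moreover have "functor_eq (dist_cat (dist_cat ?K))
      (functor_comp kleisli_convex (dist_functor (dist_cat ?K) kleisli_convex))
      (functor_comp kleisli_convex (mult_functor ?K))"
    by (auto simp: functor_eq_def functor_comp_def dist_functor_def mult_functor_def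
        kleisli_convex_dist_mult simp del: kleisli_convex_simps(2))
  ultimately show ?thesis
    using category_kleisli by (simp add: convex_category_def)
qed

end
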